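(* Let $U$ be a non-empty closed qset and let $A, B \in \mathcal{P}(U)$. Then: (i) $\emptyset^{\bot} = U$; (ii) $U^{\bot} = \emptyset$; (iii) $U - A^{\bot} = \overline{A}$; (iv) $\overline{A^{\bot}} = A^{\bot} = (\overline{A})^{\bot}$; (v) $(A^{\bot})^{\bot} = \overline{A}$ (and this equals $A$ when $A$ is closed); (vi) if $A \leq B$, then $B^{\bot} \leq A^{\bot}$.
   Context: The setting is quasi-set theory, an extension of Zermelo–Fraenkel set theory with Urelemente in which a quasi-set (qset) may contain objects ($m$-atoms) to which identity does not apply. There is a primitive indistinguishability relation $\equiv$ on objects, which is reflexive, symmetric and transitive; $x \equiv y$ does not imply that $x$ and $y$ are the same object, nor that they belong to the same qsets. Membership, subqset $\subseteq$, $\cup$, $\cap$, difference $-$ and the power qset $\mathcal{P}(U)$ (all subqsets of $U$) work as in usual set theory. The symbol $=$ between qsets is extensional equality: two qsets are equal iff they have the same elements. $U$ is a fixed non-empty qset (the universe), assumed closed, i.e. it contains all objects indistinguishable from its elements. For $A \subseteq U$, the cloud of $A$ is $\overline{A} = [\,y \in U : \exists x\,(x \in A \wedge y \equiv x)\,]$. A subqset $A \subseteq U$ is closed if $\overline{A} = A$. Define $A \sqcup B = \overline{A} \cup \overline{B}$; $A \leq B$ iff $A \sqcup B = \overline{B}$; and the generalized complement ($\mathfrak{I}$-involution) $A^{\bot} = U - \overline{A}$. *)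

theory Defs
  imports Main
begin

text \<open>
  Quasi-sets are rendered as HOL sets over a type \<open>'a\<close> of objects, on which an arbitrary
  equivalence relation \<open>ind\<close> plays the role of the primitive indistinguishability.
  Membership and the Boolean operations on quasi-sets are those of ordinary set theory, and equality
  of sets is exactly extensional equality of quasi-sets.  The type \<open>'a\<close> comprises all
  objects, including those outside the universe \<open>U\<close>.  Nothing below compares objects
  by equality, and \<open>ind x y\<close> entails neither \<open>x = y\<close> nor membership of
  \<open>x\<close> and \<open>y\<close> in the same sets.
\<close>

text \<open>
  Closedness of the universe refers to all objects.  The cloud relative to \<open>U\<close>
  cannot express it, since the cloud of \<open>U\<close> within \<open>U\<close> is always \<open>U\<close>.
\<close>
definition closed_universe :: "('a \<Rightarrow> 'a \<Rightarrow> bool) \<Rightarrow> 'a set \<Rightarrow> bool" where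
  "closed_universe ind U \<longleftrightarrow> (\<forall>x\<in>U. \<forall>y. ind y x \<longrightarrow> y \<in> U)"

definition cloud :: "('a \<Rightarrow> 'a \<Rightarrow> bool) \<Rightarrow> 'a set \<Rightarrow> 'a set \<Rightarrow> 'a set" where
  "cloud ind U A = {y \<in> U. \<exists>x. x \<in> A \<and> ind y x}"

definition qset_closed :: "('a \<Rightarrow> 'a \<Rightarrow> bool) \<Rightarrow> 'a set \<Rightarrow> 'a set \<Rightarrow> bool" where
  "qset_closed ind U A \<longleftrightarrow> A \<subseteq> U \<and> cloud ind U A = A"

definition qset_join :: "('a \<Rightarrow> 'a \<Rightarrow> bool) \<Rightarrow> 'a set \<Rightarrow> 'a set \<Rightarrow> 'a set \<Rightarrow> 'a set" where
  "qset_join ind U A B = cloud ind U A \<union> cloud ind U B"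

definition qset_le :: "('a \<Rightarrow> 'a \<Rightarrow> bool) \<Rightarrow> 'a set \<Rightarrow> 'a set \<Rightarrow> 'a set \<Rightarrow> bool" where
  "qset_le ind U A B \<longleftrightarrow> qset_join ind U A B = cloud ind U B"

definition qset_perp :: "('a \<Rightarrow> 'a \<Rightarrow> bool) \<Rightarrow> 'a set \<Rightarrow> 'a set \<Rightarrow> 'a set" where
  "qset_perp ind U A = U - cloud ind U A"

end

theory Submission
  imports Defs
begin

text \<open>
  The cloud is the saturation of a subset of \<open>U\<close> under the equivalence \<open>ind\<close>, and the
  complement in \<open>U\<close> of a saturated set is saturated.  Hence on clouds \<open>qset_perp\<close>
  is the ordinary complement and \<open>qset_le\<close> is inclusion, and all the claims reduce to
  Boolean algebra.
\<close>

text \<open>Transitivity shortens a two-step link to \<open>A\<close> into one step; reflexivity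
  gives the converse inclusion.\<close>

lemma cloud_cloud:
  assumes "reflp ind" and "transp ind"
  shows "cloud ind U (cloud ind U A) = cloud ind U A"
  using assms unfolding cloud_def by (blast dest: reflpD transpD)

lemma cloud_universe:
  assumes "reflp ind"
  shows "cloud ind U U = U"
  using assms unfolding cloud_def by (blast dest: reflpD)

text \<open>Suppose \<open>y\<close> is linked to some \<open>x\<close> outside the cloud of
  \<open>A\<close>. A link from \<open>y\<close> to a point of \<open>A\<close> would, by symmetry
  and transitivity through \<open>y\<close>, put \<open>x\<close> in that cloud.\<close>

lemma cloud_perp:
  assumes "reflp ind" and "symp ind" and "transp ind"
  shows "cloud ind U (qset_perp ind U A) = qset_perp ind U A"
  using assms unfolding cloud_def qset_perp_def by (blast dest: reflpD sympD transpD)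

lemma diff_perp: "U - qset_perp ind U A = cloud ind U A"
  unfolding qset_perp_def cloud_def by blast

lemma perp_perp:
  assumes "reflp ind" and "symp ind" and "transp ind"
  shows "qset_perp ind U (qset_perp ind U A) = cloud ind U A"
proof -
  \<comment> \<open>Only the outer \<open>qset_perp\<close> is opened: the inner one stays folded so
    that \<open>cloud_perp\<close> can absorb the cloud around it.\<close>
  have "qset_perp ind U (qset_perp ind U A) = U - cloud ind U (qset_perp ind U A)"
    by (rule qset_perp_def)
  then show ?thesis
    by (simp add: cloud_perp[OF assms] diff_perp)
qed

text \<open>A union equals its second member exactly when it absorbs the first.\<close>

lemma qset_le_iff: "qset_le ind U A B \<longleftrightarrow> cloud ind U A \<subseteq> cloud ind U B"
  unfolding qset_le_def qset_join_def by blast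

lemma perp_antimono:
  assumes "reflp ind" and "symp ind" and "transp ind" and "qset_le ind U A B"
  shows "qset_le ind U (qset_perp ind U B) (qset_perp ind U A)"
  \<comment> \<open>Once the clouds around both complements are gone, what remains is that
    complementation in \<open>U\<close> reverses inclusion.\<close>
  using assms(4) unfolding qset_le_iff cloud_perp[OF assms(1-3)] unfolding qset_perp_def by blast

theorem theorem3p9:
  fixes ind :: "'a \<Rightarrow> 'a \<Rightarrow> bool" and U A B :: "'a set"
  assumes "reflp ind" and "symp ind" and "transp ind"
    and "U \<noteq> {}" and "closed_universe ind U"
    and "A \<in> Pow U" and "B \<in> Pow U"
  shows "qset_perp ind U {} = U
    \<and> qset_perp ind U U = {}
    \<and> U - qset_perp ind U A = cloud ind U A
    \<and> (cloud ind U (qset_perp ind U A) = qset_perp ind U A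
        \<and> qset_perp ind U A = qset_perp ind U (cloud ind U A))
    \<and> (qset_perp ind U (qset_perp ind U A) = cloud ind U A
        \<and> (qset_closed ind U A \<longrightarrow> qset_perp ind U (qset_perp ind U A) = A))
    \<and> (qset_le ind U A B \<longrightarrow> qset_le ind U (qset_perp ind U B) (qset_perp ind U A))"
proof (intro conjI impI)
  note equiv = assms(1-3)
  show "qset_perp ind U {} = U"
    by (simp add: qset_perp_def cloud_def)
  show "qset_perp ind U U = {}"
    by (simp add: qset_perp_def cloud_universe[OF assms(1)])
  show "U - qset_perp ind U A = cloud ind U A"
    by (rule diff_perp)
  show "cloud ind U (qset_perp ind U A) = qset_perp ind U A"
    by (rule cloud_perp[OF equiv])
  show "qset_perp ind U A = qset_perp ind U (cloud ind U A)"
    by (simp add: qset_perp_def cloud_cloud[OF assms(1,3)])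
  show "qset_perp ind U (qset_perp ind U A) = cloud ind U A"
    by (rule perp_perp[OF equiv])
  show "qset_perp ind U (qset_perp ind U A) = A" if "qset_closed ind U A"
    using that by (simp add: perp_perp[OF equiv] qset_closed_def)
  show "qset_le ind U (qset_perp ind U B) (qset_perp ind U A)" if "qset_le ind U A B"
    using that by (rule perp_antimono[OF equiv])
qed

end
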